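(* $\mathfrak a_s\le\bar{\mathfrak o}$.
   Context: Two infinite sets are almost disjoint if their intersection is finite. $\mathfrak a_s$ is the minimum cardinality of a family $\mathcal Q$ of infinite subsets of $\omega\times\omega$ such that each member of $\mathcal Q$ meets each column $\{n\}\times\omega$ in at most one point, members of $\mathcal Q$ are pairwise almost disjoint, and $\mathcal Q$ is maximal with these properties (no infinite subset of $\omega\times\omega$ meeting each column in at most one point is almost disjoint from every member of $\mathcal Q$). Let ${}^{<\omega}\omega$ be the tree of finite sequences of natural numbers ordered by initial segment. An antichain is a set of pairwise incomparable nodes. $\bar{\mathfrak o}$ is the minimum cardinality of a maximal almost disjoint family of infinite antichains of ${}^{<\omega}\omega$ (i.e. a pairwise almost disjoint family of infinite antichains such that no infinite antichain is almost disjoint from all of its members). *)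

theory Defs
  imports "HOL-Library.Sublist"
begin

unbundle cardinal_syntax

definition almost_disjoint :: "'a set \<Rightarrow> 'a set \<Rightarrow> bool" where
  "almost_disjoint A B \<longleftrightarrow> finite (A \<inter> B)"

(* "mad P Q": Q is maximal among the pairwise almost disjoint subfamilies of P.  In both uses
   below P consists of infinite sets.  "pairwise" only compares distinct members. *)
definition mad :: "'a set set \<Rightarrow> 'a set set \<Rightarrow> bool" where
  "mad P Q \<longleftrightarrow> Q \<subseteq> P \<and> pairwise almost_disjoint Q \<and>
     \<not> (\<exists>X\<in>P. \<forall>A\<in>Q. almost_disjoint X A)"

(* The least cardinality of a member of F.  A cardinal is represented, as in the library, by a
   cardinal order, which is unique up to order isomorphism.  The value is unspecified when F
   is empty; by mad_exists below this does not arise for a_s and o_bar. *)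
definition min_card :: "'a set set \<Rightarrow> 'a rel" where
  "min_card F = (SOME r. r \<in> card_of ` F \<and> (\<forall>A\<in>F. r \<le>o |A| ))"

definition column_selectors :: "(nat \<times> nat) set set" where
  "column_selectors = {A. infinite A \<and> (\<forall>n. \<exists>\<^sub>\<le>\<^sub>1 p. p \<in> A \<inter> ({n} \<times> UNIV))}"

definition tree_antichains :: "nat list set set" where
  "tree_antichains = {A. infinite A \<and> pairwise parallel A}"

definition a_s :: "(nat \<times> nat) set rel" where
  "a_s = min_card {Q. mad column_selectors Q}"

definition o_bar :: "nat list set rel" where
  "o_bar = min_card {Q. mad tree_antichains Q}"

lemma min_card:
  assumes "F \<noteq> {}"
  shows "min_card F \<in> card_of ` F \<and> (\<forall>A\<in>F. min_card F \<le>o |A| )"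
proof -
  have "\<exists>r. r \<in> card_of ` F \<and> (\<forall>A\<in>F. r \<le>o |A| )"
    using exists_minim_Card_order[of "card_of ` F"] assms
    by (auto simp: card_of_Card_order)
  then show ?thesis
    unfolding min_card_def by (rule someI_ex)
qed

lemma mad_exists:
  assumes inf: "\<And>A. A \<in> P \<Longrightarrow> infinite A"
  shows "\<exists>Q. mad P Q"
proof -
  let ?S = "{Q. Q \<subseteq> P \<and> pairwise almost_disjoint Q}"
  have chain: "\<Union>C \<in> ?S" if C: "subset.chain ?S C" for C
  proof -
    have sub: "C \<subseteq> ?S" and lin: "\<And>x y. x \<in> C \<Longrightarrow> y \<in> C \<Longrightarrow> x \<subseteq> y \<or> y \<subseteq> x"
      using C by (auto simp only: subset_chain_def)
    have "almost_disjoint A B" if AB: "A \<in> \<Union>C" "B \<in> \<Union>C" "A \<noteq> B" for A B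
    proof -
      obtain x y where "A \<in> x" "x \<in> C" "B \<in> y" "y \<in> C"
        using AB(1,2) by (elim UnionE)
      then obtain z where z: "z \<in> C" "A \<in> z" "B \<in> z"
        using lin[of x y] by (metis subsetD)
      have "pairwise almost_disjoint z"
        using subsetD[OF sub z(1)] by simp
      then show ?thesis
        using z(2,3) AB(3) by (rule pairwiseD)
    qed
    then have "pairwise almost_disjoint (\<Union>C)"
      by (intro pairwiseI)
    moreover have "\<Union>C \<subseteq> P"
      using sub by (intro Union_least) auto
    ultimately show ?thesis
      by simp
  qed
  have "\<exists>M\<in>?S. \<forall>X\<in>?S. M \<subseteq> X \<longrightarrow> X = M"
    by (rule subset_Zorn') (rule chain)
  then obtain M where M: "M \<in> ?S" and max: "\<forall>X\<in>?S. M \<subseteq> X \<longrightarrow> X = M"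
    by (elim bexE)
  have False if X: "X \<in> P" "\<forall>A\<in>M. almost_disjoint X A" for X
  proof -
    have "insert X M \<in> ?S"
      using M X by (auto simp: pairwise_insert almost_disjoint_def Int_commute)
    then have "X \<in> M"
      using bspec[OF max, of "insert X M"] by (metis insertI1 subset_insertI)
    then show False
      using X inf by (auto simp: almost_disjoint_def)
  qed
  then have "mad P M"
    using M by (auto simp only: mad_def mem_Collect_eq)
  then show ?thesis ..
qed

end

theory Submission
  imports Defs
begin

text \<open>Send the \<open>n\<close>-th column of \<open>\<omega> \<times> \<omega>\<close> onto a chain above the node \<open>[n]\<close>. Chains above
  distinct \<open>[n]\<close> are incomparable to each other, so a set is a column selector exactly if
  its image is an antichain. Hence the infinite preimages of the members of a maximal almost
  disjoint family of antichains form a maximal almost disjoint family of column selectors.\<close>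

definition column_chain :: "nat \<times> nat \<Rightarrow> nat list" where
  "column_chain p = fst p # replicate (snd p) 0"

lemma inj_column_chain: "inj column_chain"
  by (auto simp: inj_def column_chain_def)

text \<open>Different first entries already make two nodes incomparable. With equal first entries
  the tails are constant zero sequences, and the shorter is a prefix of the longer.\<close>

lemma parallel_column_chain_iff: "column_chain p \<parallel> column_chain q \<longleftrightarrow> fst p \<noteq> fst q"
proof -
  have "prefix (replicate i (0::nat)) (replicate j 0) \<or> prefix (replicate j (0::nat)) (replicate i 0)"
    for i j
    by (metis le_add_diff_inverse nle_le prefixI replicate_add)
  then show ?thesis
    by (auto simp: column_chain_def parallel_def)
qed

lemma column_selectors_iff: "X \<in> column_selectors \<longleftrightarrow> column_chain ` X \<in> tree_antichains"
proof -
  have "pairwise parallel (column_chain ` X) \<longleftrightarrow> (\<forall>p\<in>X. \<forall>q\<in>X. p \<noteq> q \<longrightarrow> fst p \<noteq> fst q)"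
    by (simp add: pairwise_def inj_eq[OF inj_column_chain] parallel_column_chain_iff)
  moreover have "(\<forall>n. \<exists>\<^sub>\<le>\<^sub>1 p. p \<in> X \<inter> ({n} \<times> UNIV)) \<longleftrightarrow>
      (\<forall>p\<in>X. \<forall>q\<in>X. p \<noteq> q \<longrightarrow> fst p \<noteq> fst q)"
    by (fastforce simp: Uniq_def)
  moreover have "finite (column_chain ` X) \<longleftrightarrow> finite X"
    by (meson finite_image_iff inj_column_chain inj_on_subset subset_UNIV)
  ultimately show ?thesis
    by (simp add: column_selectors_def tree_antichains_def)
qed

lemma tree_antichains_subset:
  "A \<in> tree_antichains \<Longrightarrow> B \<subseteq> A \<Longrightarrow> infinite B \<Longrightarrow> B \<in> tree_antichains"
  by (auto simp: tree_antichains_def intro: pairwise_subset)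

text \<open>An antichain in \<open>Q\<close> may meet the range of \<open>column_chain\<close> in a
  finite set only, hence the restriction to infinite preimages. Maximality survives it, since a
  discarded preimage cannot meet a selector in an infinite set.\<close>

lemma mad_column_selectors_vimage:
  assumes "mad tree_antichains Q"
  shows "mad column_selectors {X \<in> vimage column_chain ` Q. infinite X}"
  unfolding mad_def
proof (intro conjI)
  have Q: "Q \<subseteq> tree_antichains" "pairwise almost_disjoint Q"
    and max: "\<And>X. X \<in> tree_antichains \<Longrightarrow> \<exists>A\<in>Q. infinite (X \<inter> A)"
    using assms by (auto simp: mad_def almost_disjoint_def)
  show "{X \<in> vimage column_chain ` Q. infinite X} \<subseteq> column_selectors"
  proof
    fix X assume "X \<in> {X \<in> vimage column_chain ` Q. infinite X}"
    then obtain A where "A \<in> Q" "X = column_chain -` A" "infinite X" by auto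
    moreover from this have "infinite (column_chain ` X)"
      by (meson finite_imageD inj_column_chain inj_on_subset subset_UNIV)
    ultimately show "X \<in> column_selectors"
      using Q(1) by (auto simp: column_selectors_iff intro: tree_antichains_subset)
  qed
  \<comment> \<open>Distinct preimages come from distinct members of \<open>Q\<close>, so this case
    suffices.\<close>
  have "almost_disjoint (column_chain -` A) (column_chain -` B)"
    if "A \<in> Q" "B \<in> Q" "A \<noteq> B" for A B
  proof -
    have "finite (A \<inter> B)"
      using pairwiseD[OF Q(2) that] by (simp add: almost_disjoint_def)
    then show ?thesis
      using finite_vimageI[OF _ inj_column_chain] by (simp add: almost_disjoint_def flip: vimage_Int)
  qed
  then show "pairwise almost_disjoint {X \<in> vimage column_chain ` Q. infinite X}"
    by (fastforce simp: pairwise_def)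
  show "\<not> (\<exists>X\<in>column_selectors. \<forall>A\<in>{X \<in> vimage column_chain ` Q. infinite X}. almost_disjoint X A)"
  proof
    assume "\<exists>X\<in>column_selectors. \<forall>A\<in>{X \<in> vimage column_chain ` Q. infinite X}. almost_disjoint X A"
    then obtain X where X: "X \<in> column_selectors"
      and ad: "\<And>A. A \<in> Q \<Longrightarrow> infinite (column_chain -` A) \<Longrightarrow> finite (X \<inter> column_chain -` A)"
      by (auto simp: almost_disjoint_def)
    obtain A where A: "A \<in> Q" "infinite (column_chain ` X \<inter> A)"
      using max X by (auto simp: column_selectors_iff)
    have "column_chain ` X \<inter> A = column_chain ` (X \<inter> column_chain -` A)" by auto
    with A(2) have "infinite (X \<inter> column_chain -` A)" by auto
    \<comment> \<open>The preimage of \<open>A\<close> contains this infinite set, so it was kept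
      and \<open>ad\<close> applies to it.\<close>
    with ad[OF A(1)] show False by auto
  qed
qed

theorem theorem4p3:
  shows "a_s \<le>o o_bar"
proof -
  \<comment> \<open>Nonemptiness ensures that the minimum \<open>o_bar\<close> is attained by an
    actual family.\<close>
  have "{Q. mad tree_antichains Q} \<noteq> {}"
    using mad_exists[of tree_antichains] by (auto simp: tree_antichains_def)
  from min_card[OF this] obtain Q where Q: "mad tree_antichains Q" "o_bar = |Q|"
    by (auto simp: o_bar_def)
  let ?R = "{X \<in> vimage column_chain ` Q. infinite X}"
  have R: "mad column_selectors ?R"
    using Q(1) by (rule mad_column_selectors_vimage)
  \<comment> \<open>Here \<open>?R\<close> itself witnesses the nonemptiness that
    \<open>min_card\<close> requires.\<close>
  then have "a_s \<le>o |?R|"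
    using min_card[of "{Q. mad column_selectors Q}"] by (auto simp: a_s_def)
  also have "|?R| \<le>o |vimage column_chain ` Q|"
    by (rule card_of_mono1) auto
  also have "|vimage column_chain ` Q| \<le>o |Q|"
    by (rule card_of_image)
  finally show ?thesis
    using Q(2) by simp
qed

end
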